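(* Let $n,k\ge 1$ be integers and let $g$ be a function from an open subset of $\mathbb{R}^{n_x}$ to $\mathbb{R}^{n_y}$ that is $n$ times differentiable for (i) and $n+1$ times differentiable for (ii) and (iii). Let $D$ be any real $1\times n_y$ vector and $X$ any real $n_x\times 1$ vector, and put $D_k=D^{\otimes k}$, $X_m=X^{\otimes m}$. Then at every point $x$ of the domain of $g$ the following recurrences hold for the multivariate partial Bell polynomials: (i) $\displaystyle D_k\,\mathbf{B}^g_{n,k}\,X_n = D_k\left[\sum_{i=1}^{n-k+1}\binom{n-1}{i-1}\left(\mathbf{B}^g_{n-i,k-1}\otimes g_{x^i}\right)\right]X_n$; (ii) $\displaystyle D_k\,\frac{\partial \mathbf{B}^g_{n,k}}{\partial x'}\,X_{n+1} = D_k\left[\sum_{i=1}^{n-k+1}\binom{n}{i}\left(\mathbf{B}^g_{n-i,k-1}\otimes g_{x^{i+1}}\right)\right]X_{n+1}$; (iii) $\displaystyle D_k\,\mathbf{B}^g_{n+1,k}\,X_{n+1} = D_k\left[\left(\mathbf{B}^g_{n,k-1}\otimes g_x\right)+\frac{\partial \mathbf{B}^g_{n,k}}{\partial x'}\right]X_{n+1}$.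
   Context: $\otimes$ is the Kronecker product and $A^{\otimes m}$ the $m$-fold Kronecker power ($A^{\otimes 0}=1$). Matrix derivatives: put $\frac{\partial}{\partial x'}=\left(\frac{\partial}{\partial x_1},\dots,\frac{\partial}{\partial x_{n_x}}\right)$ (a row). For a matrix function $F$ of the column vector $x\in\mathbb{R}^{n_x}$, $F_x=\frac{\partial F}{\partial x'}:=F\otimes\frac{\partial}{\partial x'}$, i.e. each entry $F_{i,j}$ is replaced by the row $\left(\frac{\partial F_{i,j}}{\partial x_1},\dots,\frac{\partial F_{i,j}}{\partial x_{n_x}}\right)$; iterating, $F_{x^k}:=F\otimes\left(\frac{\partial}{\partial x'}\right)^{\otimes k}$. Thus $g_{x^l}$ is the $n_y\times n_x^l$ matrix of $l$-th order partial derivatives of $g$. Multivariate partial Bell polynomial: for $1\le k\le n$, $\mathbf{B}^g_{n,k}$ is the $n_y^k\times n_x^n$ matrix $$\mathbf{B}^g_{n,k}=\sum \frac{n!}{j_1!j_2!\cdots j_{n-k+1}!}\left(\frac{g_x(x)}{1!}\right)^{\otimes j_1}\otimes\left(\frac{g_{x^2}(x)}{2!}\right)^{\otimes j_2}\otimes\cdots\otimes\left(\frac{g_{x^{n-k+1}}(x)}{(n-k+1)!}\right)^{\otimes j_{n-k+1}},$$ the sum being over all sequences $j_1,\dots,j_{n-k+1}$ of non-negative integers with $\sum_l j_l=k$ and $\sum_l l\,j_l=n$. Conventions: $\mathbf{B}^g_{n,k}=0$ (the zero $n_y^k\times n_x^n$ matrix) for $k>n$; $\mathbf{B}^g_{n,0}=0$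 for $n\ge1$; $\mathbf{B}^g_{0,0}=1$. Empty sums are zero. *)

theory Defs
  imports "HOL-Analysis.Analysis" "Jordan_Normal_Form.Matrix"
begin

text \<open>
  The matrix sizes below are powers with varying exponents, so matrices have the type
  \<^typ>\<open>real mat\<close> with explicit dimensions. Rows and columns are numbered from \<open>0\<close>.
\<close>


definition kronecker :: "real mat \<Rightarrow> real mat \<Rightarrow> real mat" (infixl "\<otimes>\<^sub>K" 70) where
  "A \<otimes>\<^sub>K B = Matrix.mat (dim_row A * dim_row B) (dim_col A * dim_col B)
     (\<lambda>(i, j). A $$ (i div dim_row B, j div dim_col B) * B $$ (i mod dim_row B, j mod dim_col B))"

primrec kronecker_power :: "real mat \<Rightarrow> nat \<Rightarrow> real mat" where
  "kronecker_power A 0 = 1\<^sub>m 1"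
| "kronecker_power A (Suc m) = kronecker_power A m \<otimes>\<^sub>K A"

definition kronecker_list :: "real mat list \<Rightarrow> real mat" where
  "kronecker_list As = foldl (\<otimes>\<^sub>K) (1\<^sub>m 1) As"

text \<open>
  \<^typ>\<open>real mat\<close> has no single zero, hence no instance of \<^const>\<open>sum\<close>; the dimensions are
  arguments so that the empty sum is the zero matrix of the right size. All summands are
  meant to have these dimensions.
\<close>

definition mat_sum :: "nat \<Rightarrow> nat \<Rightarrow> ('i \<Rightarrow> real mat) \<Rightarrow> 'i set \<Rightarrow> real mat" where
  "mat_sum r c A I = Matrix.mat r c (\<lambda>ij. \<Sum>i\<in>I. A i $$ ij)"


text \<open>
  The coordinates \<open>x\<^sub>1, x\<^sub>2, \<dots>\<close> of a vector are listed in the order of its index type;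
  the position \<open>i\<close> starts at \<open>0\<close>.
\<close>

definition idx :: "nat \<Rightarrow> 'a::{finite,linorder}" where
  "idx i = sorted_list_of_set UNIV ! i"

lemma bij_betw_idx: "bij_betw idx {..<CARD('a::{finite,linorder})} (UNIV :: 'a set)"
  unfolding idx_def by (rule bij_betw_nth) auto

definition column :: "real ^ 'a::{finite,linorder} \<Rightarrow> real mat" where
  "column v = Matrix.mat CARD('a) 1 (\<lambda>(i, j). vec_nth v (idx i))"

definition partial :: "'a::{finite,linorder} \<Rightarrow> (real ^ 'a::{finite,linorder} \<Rightarrow> real) \<Rightarrow> real ^ 'a::{finite,linorder} \<Rightarrow> real" where
  "partial a f x = deriv (\<lambda>t. f (x + t *\<^sub>R axis a 1)) 0"

text \<open>
  \<open>F \<otimes> \<partial>/\<partial>x'\<close>: every entry of \<open>F\<close> is replaced by the row of its partial derivatives.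
\<close>

definition mat_deriv ::
  "(real ^ 'a::{finite,linorder} \<Rightarrow> real mat) \<Rightarrow> real ^ 'a::{finite,linorder} \<Rightarrow> real mat" where
  "mat_deriv F x = Matrix.mat (dim_row (F x)) (dim_col (F x) * CARD('a))
     (\<lambda>(i, j). partial (idx (j mod CARD('a))) (\<lambda>y. F y $$ (i, j div CARD('a))) x)"

definition nth_mat_deriv ::
  "(real ^ 'a::{finite,linorder} \<Rightarrow> real ^ 'b::{finite,linorder}) \<Rightarrow> nat \<Rightarrow> real ^ 'a::{finite,linorder} \<Rightarrow> real mat"
where
  "nth_mat_deriv g l = (mat_deriv ^^ l) (\<lambda>x. column (g x))"

text \<open>
  \<open>n\<close> times (Frechet) differentiable on an open set; the derivatives of order \<open>n\<close> need not
  be continuous. In finite dimension the derivative, as a map into the linear maps, is \<open>n\<close>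
  times differentiable iff its value at each fixed direction \<open>v\<close> is.
\<close>

primrec times_differentiable_on ::
  "nat \<Rightarrow> ('v::euclidean_space \<Rightarrow> 'w::euclidean_space) \<Rightarrow> 'v set \<Rightarrow> bool"
where
  "times_differentiable_on 0 f U \<longleftrightarrow> True"
| "times_differentiable_on (Suc n) f U \<longleftrightarrow>
     (\<forall>x\<in>U. f differentiable (at x)) \<and>
     (\<forall>v. times_differentiable_on n (\<lambda>x. frechet_derivative f (at x) v) U)"


text \<open>
  A sequence \<open>j\<^sub>1, \<dots>, j\<^bsub>n-k+1\<^esub>\<close> is a list, so its member \<open>j\<^sub>l\<close> is \<open>js ! (l - 1)\<close>.
\<close>

definition bell_seqs :: "nat \<Rightarrow> nat \<Rightarrow> nat list set" where
  "bell_seqs n k = {js. length js = n - k + 1 \<and>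
     (\<Sum>l = 1..n - k + 1. js ! (l - 1)) = k \<and> (\<Sum>l = 1..n - k + 1. l * js ! (l - 1)) = n}"

definition bell ::
  "(real ^ 'a::{finite,linorder} \<Rightarrow> real ^ 'b::{finite,linorder}) \<Rightarrow> nat \<Rightarrow> nat \<Rightarrow> real ^ 'a::{finite,linorder} \<Rightarrow> real mat"
where
  "bell g n k x =
     (if n = 0 \<and> k = 0 then 1\<^sub>m 1
      else if k = 0 \<or> n < k then 0\<^sub>m (CARD('b) ^ k) (CARD('a) ^ n)
      else mat_sum (CARD('b) ^ k) (CARD('a) ^ n)
        (\<lambda>js. (fact n / (\<Prod>l = 1..n - k + 1. fact (js ! (l - 1)))) \<cdot>\<^sub>m
           kronecker_list
             (map (\<lambda>l. kronecker_power ((1 / fact l) \<cdot>\<^sub>m nth_mat_deriv g l x) (js ! (l - 1)))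
               [1..<n - k + 2]))
        (bell_seqs n k))"

lemma finite_bell_seqs: "finite (bell_seqs n k)"
proof (rule finite_subset)
  show "bell_seqs n k \<subseteq> {js. set js \<subseteq> {..k} \<and> length js = n - k + 1}"
  proof (intro subsetI CollectI conjI)
    fix js assume js: "js \<in> bell_seqs n k"
    then show len: "length js = n - k + 1"
      by (simp add: bell_seqs_def)
    fix j assume "j \<in> set js"
    then obtain i where i: "i < length js" "j = js ! i"
      by (auto simp: in_set_conv_nth)
    have "js ! (Suc i - 1) \<le> (\<Sum>l = 1..n - k + 1. js ! (l - 1))"
      using i len by (intro member_le_sum) auto
    then show "j \<in> {..k}"
      using i js by (simp add: bell_seqs_def)
  qed
  show "finite {js. set js \<subseteq> {..k} \<and> length js = n - k + 1}"
    by (rule finite_lists_length_eq) simp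
qed

end

theory Submission
  imports Defs
begin

text \<open>
  The Kronecker mixed product law makes the contraction \<open>A \<mapsto> D\<^sub>k A X\<^sub>n\<close> multiplicative for
  \<open>\<otimes>\<^sub>K\<close>, so all three recurrences reduce to scalar ones. With \<open>y\<^sub>l = D g\<^bsub>x^l\<^esub> X\<^sub>l\<close> and
  \<open>Y = \<Sum>\<^bsub>l \<ge> 1\<^esub> y\<^sub>l t\<^sup>l / l!\<close>, the multinomial theorem gives \<open>D\<^sub>k B\<^bsub>n,k\<^esub> X\<^sub>n = n!/k! [t\<^sup>n] Y\<^sup>k\<close>.
  Recurrence (i) is the coefficient form of \<open>dY\<^sup>k/dt = k Y\<^bsup>k-1\<^esup> dY/dt\<close>. Contracting a matrix
  derivative with one more factor \<open>X\<close> is differentiation in the direction \<open>X\<close>, which maps \<open>y\<^sub>l\<close> to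
  \<open>y\<^bsub>l+1\<^esub>\<close>; the chain rule for \<open>Y\<^sup>k\<close> in that direction is (ii). Splitting the term \<open>i = 1\<close> off (i)
  at \<open>n + 1\<close> and comparing with (ii) gives (iii).
\<close>

section \<open>Kronecker products and contraction\<close>

lemma kronecker_carrier [simp]:
  "A \<in> carrier_mat r c \<Longrightarrow> B \<in> carrier_mat r' c' \<Longrightarrow> A \<otimes>\<^sub>K B \<in> carrier_mat (r * r') (c * c')"
  by (auto simp: kronecker_def)

lemma dim_kronecker [simp]:
  "dim_row (A \<otimes>\<^sub>K B) = dim_row A * dim_row B" "dim_col (A \<otimes>\<^sub>K B) = dim_col A * dim_col B"
  by (auto simp: kronecker_def)

lemma index_kronecker:
  "i < dim_row A * dim_row B \<Longrightarrow> j < dim_col A * dim_col B \<Longrightarrow>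
   (A \<otimes>\<^sub>K B) $$ (i, j) =
     A $$ (i div dim_row B, j div dim_col B) * B $$ (i mod dim_row B, j mod dim_col B)"
  by (auto simp: kronecker_def)

lemma div_mod_less_mult:
  fixes i m n :: nat
  assumes "i < m * n"
  shows "i div n < m" "i mod n < n"
proof -
  have "0 < n" using assms by (cases n) auto
  then show "i div n < m" "i mod n < n"
    using assms by (auto simp: less_mult_imp_div_less)
qed

text \<open>Division with remainder by n identifies indices below m * n with pairs. Every index of a
  Kronecker product is read this way, so this is how a sum over such an index becomes a double
  sum.\<close>

lemma sum_lessThan_mult:
  fixes f :: "nat \<Rightarrow> nat \<Rightarrow> 'a::comm_monoid_add"
  shows "(\<Sum>i<m * n. f (i div n) (i mod n)) = (\<Sum>p<m. \<Sum>q<n. f p q)"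
proof -
  have "(\<Sum>p<m. \<Sum>q<n. f p q) = (\<Sum>(p, q)\<in>{..<m} \<times> {..<n}. f p q)"
    by (simp add: sum.cartesian_product)
  also have "\<dots> = (\<Sum>i<m * n. f (i div n) (i mod n))"
  proof (rule sum.reindex_bij_witness[where i = "\<lambda>i. (i div n, i mod n)" and j = "\<lambda>(p, q). p * n + q"])
    fix a assume "a \<in> {..<m} \<times> {..<n}"
    then obtain p q where pq: "a = (p, q)" "p < m" "q < n" by auto
    have "p * n + q < Suc p * n" using pq by simp
    also have "\<dots> \<le> m * n" using pq by (intro mult_right_mono) auto
    finally show "(case a of (p, q) \<Rightarrow> p * n + q) \<in> {..<m * n}" using pq by simp
  qed (auto simp: div_mod_less_mult)
  finally show ?thesis by simp
qed

text \<open>Both bracketings read an index as the same three mixed-radix digits, and multiplication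
  of the entries is associative.\<close>

lemma kronecker_assoc: "(A \<otimes>\<^sub>K B) \<otimes>\<^sub>K C = A \<otimes>\<^sub>K (B \<otimes>\<^sub>K C)"
proof (rule eq_matI)
  fix i j assume "i < dim_row (A \<otimes>\<^sub>K (B \<otimes>\<^sub>K C))" "j < dim_col (A \<otimes>\<^sub>K (B \<otimes>\<^sub>K C))"
  then have i: "i < dim_row A * dim_row B * dim_row C" and j: "j < dim_col A * dim_col B * dim_col C"
    by (simp_all add: mult.assoc)
  have i': "i < dim_row A * (dim_row B * dim_row C)" and j': "j < dim_col A * (dim_col B * dim_col C)"
    using i j by (simp_all add: mult.assoc)
  note b = div_mod_less_mult[OF i] div_mod_less_mult[OF j] div_mod_less_mult[OF i'] div_mod_less_mult[OF j']
  have "((A \<otimes>\<^sub>K B) \<otimes>\<^sub>K C) $$ (i, j) =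
      (A \<otimes>\<^sub>K B) $$ (i div dim_row C, j div dim_col C) * C $$ (i mod dim_row C, j mod dim_col C)"
    using i j by (subst index_kronecker) auto
  also have "\<dots> = A $$ (i div dim_row C div dim_row B, j div dim_col C div dim_col B) *
      (B $$ (i div dim_row C mod dim_row B, j div dim_col C mod dim_col B) *
       C $$ (i mod dim_row C, j mod dim_col C))"
    using b by (subst index_kronecker) auto
  also have "\<dots> = A $$ (i div (dim_row B * dim_row C), j div (dim_col B * dim_col C)) *
      (B \<otimes>\<^sub>K C) $$ (i mod (dim_row B * dim_row C), j mod (dim_col B * dim_col C))"
    using b by (subst index_kronecker)
      (simp_all add: mult.commute[of "dim_row B"] mult.commute[of "dim_col B"] div_mult2_eq mod_mult2_eq)
  also have "\<dots> = (A \<otimes>\<^sub>K (B \<otimes>\<^sub>K C)) $$ (i, j)"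
    using i' j' by (subst index_kronecker) auto
  finally show "((A \<otimes>\<^sub>K B) \<otimes>\<^sub>K C) $$ (i, j) = (A \<otimes>\<^sub>K (B \<otimes>\<^sub>K C)) $$ (i, j)" .
qed (simp_all add: mult.assoc)

text \<open>The summation index h of the right-hand product splits into a pair (p, q). Each summand
  is a function of p times a function of q, so the double sum factors into one entry of
  \<open>A * B\<close> and one of \<open>A' * B'\<close>.\<close>

lemma kronecker_mult_distrib:
  assumes A: "A \<in> carrier_mat r m" and B: "B \<in> carrier_mat m c"
    and A': "A' \<in> carrier_mat r' m'" and B': "B' \<in> carrier_mat m' c'"
  shows "(A * B) \<otimes>\<^sub>K (A' * B') = (A \<otimes>\<^sub>K A') * (B \<otimes>\<^sub>K B')"
proof (rule eq_matI)
  fix i j assume "i < dim_row ((A \<otimes>\<^sub>K A') * (B \<otimes>\<^sub>K B'))" "j < dim_col ((A \<otimes>\<^sub>K A') * (B \<otimes>\<^sub>K B'))"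
  then have i: "i < r * r'" and j: "j < c * c'" using assms by auto
  note b = div_mod_less_mult[OF i] div_mod_less_mult[OF j]
  have "((A \<otimes>\<^sub>K A') * (B \<otimes>\<^sub>K B')) $$ (i, j) =
    (\<Sum>h<m * m'. (A \<otimes>\<^sub>K A') $$ (i, h) * (B \<otimes>\<^sub>K B') $$ (h, j))"
    using i j assms by (auto simp: scalar_prod_def atLeast0LessThan intro!: sum.cong)
  also have "\<dots> = (\<Sum>h<m * m'. (A $$ (i div r', h div m') * A' $$ (i mod r', h mod m')) *
      (B $$ (h div m', j div c') * B' $$ (h mod m', j mod c')))"
    using i j assms by (intro sum.cong refl) (auto simp: index_kronecker)
  also have "\<dots> = (\<Sum>p<m. \<Sum>q<m'. (A $$ (i div r', p) * A' $$ (i mod r', q)) *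
      (B $$ (p, j div c') * B' $$ (q, j mod c')))"
    by (rule sum_lessThan_mult)
  also have "\<dots> = (\<Sum>p<m. A $$ (i div r', p) * B $$ (p, j div c')) *
      (\<Sum>q<m'. A' $$ (i mod r', q) * B' $$ (q, j mod c'))"
    by (simp add: sum_product mult_ac)
  also have "\<dots> = ((A * B) \<otimes>\<^sub>K (A' * B')) $$ (i, j)"
    using i j b assms by (auto simp: index_kronecker scalar_prod_def atLeast0LessThan)
  finally show "((A * B) \<otimes>\<^sub>K (A' * B')) $$ (i, j) = ((A \<otimes>\<^sub>K A') * (B \<otimes>\<^sub>K B')) $$ (i, j)"
    by simp
qed (use assms in auto)

text \<open>\<open>Suc 0\<close> is the form to which the simplifier rewrites the size 1.\<close>

lemma kronecker_one [simp]: "A \<otimes>\<^sub>K 1\<^sub>m (Suc 0) = A" "1\<^sub>m (Suc 0) \<otimes>\<^sub>K A = A"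
  by (rule eq_matI; auto simp: index_kronecker less_mult_imp_div_less)+

lemma kronecker_power_carrier [simp]:
  "A \<in> carrier_mat r c \<Longrightarrow> kronecker_power A m \<in> carrier_mat (r ^ m) (c ^ m)"
  by (induction m) (auto simp: mult.commute[of r] mult.commute[of c])

lemma kronecker_power_row: "D \<in> carrier_mat 1 b \<Longrightarrow> kronecker_power D k \<in> carrier_mat 1 (b ^ k)"
  using kronecker_power_carrier[of D 1 b k] by simp

lemma kronecker_power_column: "X \<in> carrier_mat a 1 \<Longrightarrow> kronecker_power X n \<in> carrier_mat (a ^ n) 1"
  using kronecker_power_carrier[of X a 1 n] by simp

lemma kronecker_power_add:
  "kronecker_power A (m + n) = kronecker_power A m \<otimes>\<^sub>K kronecker_power A n"
  by (induction n) (simp_all add: kronecker_assoc)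

section \<open>Contraction with powers of a row D and a column X\<close>

text \<open>For a row D and a column X of fitting sizes the product is a 1 x 1 matrix. Its only
  entry carries all the information and, being a real number, can be summed and
  differentiated.\<close>

definition contract :: "real mat \<Rightarrow> real mat \<Rightarrow> nat \<Rightarrow> nat \<Rightarrow> real mat \<Rightarrow> real" where
  "contract D X k n A = (kronecker_power D k * A * kronecker_power X n) $$ (0, 0)"

context
  fixes D X :: "real mat" and b a :: nat
  assumes D: "D \<in> carrier_mat 1 b" and X: "X \<in> carrier_mat a 1"
begin

lemmas D_power = kronecker_power_row[OF D] and X_power = kronecker_power_column[OF X]

lemma contract_eq_iff:
  assumes "A \<in> carrier_mat (b ^ k) (a ^ n)" "B \<in> carrier_mat (b ^ k) (a ^ n)"
  shows "kronecker_power D k * A * kronecker_power X n = kronecker_power D k * B * kronecker_power X n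
    \<longleftrightarrow> contract D X k n A = contract D X k n B"
proof
  assume "contract D X k n A = contract D X k n B"
  then show "kronecker_power D k * A * kronecker_power X n = kronecker_power D k * B * kronecker_power X n"
    using carrier_matD[OF D_power[of k]] carrier_matD[OF X_power[of n]]
    unfolding contract_def by (intro eq_matI) auto
qed (simp add: contract_def)

text \<open>This form shows that the contraction is a fixed linear combination of the entries of A.
  Additivity, homogeneity, finite sums and derivatives all go through it.\<close>

lemma contract_sum:
  assumes "A \<in> carrier_mat (b ^ k) (a ^ n)"
  shows "contract D X k n A =
    (\<Sum>i<b ^ k. \<Sum>j<a ^ n. kronecker_power D k $$ (0, i) * kronecker_power X n $$ (j, 0) * A $$ (i, j))"
proof -
  have "contract D X k n A =
    (\<Sum>j<a ^ n. (kronecker_power D k * A) $$ (0, j) * kronecker_power X n $$ (j, 0))"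
    using assms carrier_matD[OF D_power[of k]] carrier_matD[OF X_power[of n]] unfolding contract_def
    by (subst index_mult_mat) (auto simp: scalar_prod_def atLeast0LessThan simp del: index_mult_mat(1))
  also have "\<dots> =
    (\<Sum>j<a ^ n. (\<Sum>i<b ^ k. kronecker_power D k $$ (0, i) * A $$ (i, j)) * kronecker_power X n $$ (j, 0))"
    using assms carrier_matD[OF D_power[of k]]
    by (auto simp: scalar_prod_def atLeast0LessThan)
  finally show ?thesis
    by (subst sum.swap) (simp add: sum_distrib_left sum_distrib_right mult_ac)
qed

lemma contract_one: "contract D X 0 0 (1\<^sub>m 1) = 1"
  by (simp add: contract_def)

lemma contract_zero: "contract D X k n (0\<^sub>m (b ^ k) (a ^ n)) = 0"
  by (simp add: contract_sum)

lemma contract_add: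
  assumes "A \<in> carrier_mat (b ^ k) (a ^ n)" "B \<in> carrier_mat (b ^ k) (a ^ n)"
  shows "contract D X k n (A + B) = contract D X k n A + contract D X k n B"
proof -
  have "A + B \<in> carrier_mat (b ^ k) (a ^ n)" using assms by simp
  then show ?thesis
    using assms by (simp add: contract_sum algebra_simps flip: sum.distrib)
qed

lemma contract_smult:
  assumes "A \<in> carrier_mat (b ^ k) (a ^ n)"
  shows "contract D X k n (c \<cdot>\<^sub>m A) = c * contract D X k n A"
  using assms by (simp add: contract_sum sum_distrib_left mult_ac)

lemma contract_mat_sum:
  assumes "\<And>i. i \<in> I \<Longrightarrow> A i \<in> carrier_mat (b ^ k) (a ^ n)"
  shows "contract D X k n (mat_sum (b ^ k) (a ^ n) A I) = (\<Sum>i\<in>I. contract D X k n (A i))"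
proof -
  have "contract D X k n (mat_sum (b ^ k) (a ^ n) A I) =
    (\<Sum>i<b ^ k. \<Sum>j<a ^ n. \<Sum>h\<in>I. kronecker_power D k $$ (0, i) * kronecker_power X n $$ (j, 0) * A h $$ (i, j))"
    by (subst contract_sum) (auto simp: mat_sum_def sum_distrib_left)
  also have "\<dots> = (\<Sum>h\<in>I. \<Sum>i<b ^ k. \<Sum>j<a ^ n. kronecker_power D k $$ (0, i) * kronecker_power X n $$ (j, 0) * A h $$ (i, j))"
    by (subst sum.swap[of _ "I"], subst sum.swap[of _ "I"]) (rule refl)
  finally show ?thesis using assms by (simp add: contract_sum)
qed

text \<open>Split D's power as D_k \<otimes> D_l and X's as X_n \<otimes> X_m. Two uses of the mixed
  product law leave a Kronecker product of two 1 x 1 matrices, whose entry is the product of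
  theirs.\<close>

lemma contract_kronecker:
  assumes A: "A \<in> carrier_mat (b ^ k) (a ^ n)" and B: "B \<in> carrier_mat (b ^ l) (a ^ m)"
  shows "contract D X (k + l) (n + m) (A \<otimes>\<^sub>K B) = contract D X k n A * contract D X l m B"
proof -
  have "kronecker_power D (k + l) * (A \<otimes>\<^sub>K B) * kronecker_power X (n + m) =
    (kronecker_power D k * A * kronecker_power X n) \<otimes>\<^sub>K (kronecker_power D l * B * kronecker_power X m)"
    using D_power X_power A B
    by (simp add: kronecker_power_add kronecker_mult_distrib[where r = 1 and r' = 1 and c = 1 and c' = 1, OF mult_carrier_mat[OF D_power A] X_power mult_carrier_mat[OF D_power B] X_power]
     kronecker_mult_distrib[OF D_power A D_power B])
  then show ?thesis
    unfolding contract_def using carrier_matD[OF D_power] carrier_matD[OF X_power] by (simp add: index_kronecker)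
qed

lemma contract_kronecker_power:
  assumes A: "A \<in> carrier_mat b (a ^ l)"
  shows "contract D X j (j * l) (kronecker_power A j) = contract D X 1 l A ^ j"
proof (induction j)
  case 0
  show ?case using contract_one by simp
next
  case (Suc j)
  have "kronecker_power A j \<in> carrier_mat (b ^ j) (a ^ (j * l))"
    using kronecker_power_carrier[OF A, of j] by (simp add: power_mult[symmetric] mult.commute)
  from contract_kronecker[OF this, of A 1 l] A Suc show ?case by (simp add: add.commute)
qed

text \<open>Here \<open>A l\<close> has the shape of g_{x^l}, so the size of the product is governed
  by exactly the two sums that a Bell sequence fixes, and contraction turns the product into a
  scalar monomial. Since \<open>kronecker_list\<close> folds from the left, the induction splits off
  the last factor.\<close>

lemma contract_kronecker_list:
  assumes A: "\<And>l. A l \<in> carrier_mat b (a ^ l)"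
  defines "K \<equiv> \<lambda>N js. kronecker_list (map (\<lambda>l. kronecker_power (A l) (js ! (l - 1))) [1..<N + 1])"
  shows "K N js \<in> carrier_mat (b ^ (\<Sum>l = 1..N. js ! (l - 1))) (a ^ (\<Sum>l = 1..N. l * js ! (l - 1)))"
    and "contract D X (\<Sum>l = 1..N. js ! (l - 1)) (\<Sum>l = 1..N. l * js ! (l - 1)) (K N js) =
      (\<Prod>l = 1..N. contract D X 1 l (A l) ^ (js ! (l - 1)))"
proof (induction N)
  case 0
  { case 1 show ?case by (simp add: K_def kronecker_list_def) }
  { case 2 show ?case using contract_one by (simp add: K_def kronecker_list_def) }
next
  case (Suc N)
  have K: "K (Suc N) js = K N js \<otimes>\<^sub>K kronecker_power (A (Suc N)) (js ! N)"
    by (simp add: K_def kronecker_list_def)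
  have P: "kronecker_power (A (Suc N)) (js ! N) \<in> carrier_mat (b ^ (js ! N)) (a ^ ((js ! N) * Suc N))"
    using kronecker_power_carrier[OF A, of "Suc N" "js ! N"]
    by (simp only: power_mult[symmetric] mult.commute)
  { case 1 show ?case
      using kronecker_carrier[OF Suc(1) P] by (simp add: K power_add mult.commute) }
  { case 2 show ?case
      using contract_kronecker[OF Suc(1) P] contract_kronecker_power[OF A, of "js ! N" "Suc N"] Suc(2)
      by (simp add: K mult.commute) }
qed

end

section \<open>Scalar Bell polynomials\<close>

lemma prod_append_nth:
  fixes f :: "nat \<Rightarrow> 'c \<Rightarrow> 'd::comm_monoid_mult"
  assumes "length js = N"
  shows "(\<Prod>l = 1..Suc N. f l ((js @ [j]) ! (l - 1))) = (\<Prod>l = 1..N. f l (js ! (l - 1))) * f (Suc N) j"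
proof -
  have "(\<Prod>l = 1..N. f l ((js @ [j]) ! (l - 1))) = (\<Prod>l = 1..N. f l (js ! (l - 1)))"
    using assms by (intro prod.cong refl) (auto simp: nth_append)
  then show ?thesis using assms by (simp add: nth_append)
qed

lemma sum_append_nth:
  fixes f :: "nat \<Rightarrow> 'c \<Rightarrow> 'd::comm_monoid_add"
  assumes "length js = N"
  shows "(\<Sum>l = 1..Suc N. f l ((js @ [j]) ! (l - 1))) = (\<Sum>l = 1..N. f l (js ! (l - 1))) + f (Suc N) j"
proof -
  have "(\<Sum>l = 1..N. f l ((js @ [j]) ! (l - 1))) = (\<Sum>l = 1..N. f l (js ! (l - 1)))"
    using assms by (intro sum.cong refl) (auto simp: nth_append)
  then show ?thesis using assms by (simp add: nth_append)
qed

text \<open>The index set of the multinomial theorem. The second condition on a Bell sequence, on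
  its weighted sum, is left out; it appears later when one coefficient of a power series is
  extracted.\<close>

definition compositions :: "nat \<Rightarrow> nat \<Rightarrow> nat list set" where
  "compositions N k = {js. length js = N \<and> (\<Sum>l = 1..N. js ! (l - 1)) = k}"

lemma compositions_0: "compositions 0 k = (if k = 0 then {[]} else {})"
  by (auto simp: compositions_def)

lemma compositions_Suc:
  "compositions (Suc N) k = (\<lambda>(j, js). js @ [j]) ` (SIGMA j:{..k}. compositions N (k - j))"
proof (intro equalityI subsetI)
  fix xs assume xs: "xs \<in> compositions (Suc N) k"
  then obtain js j where js: "xs = js @ [j]" "length js = N"
    by (auto simp: compositions_def length_Suc_conv_rev)
  then have "(\<Sum>l = 1..N. js ! (l - 1)) + j = k"
    using xs sum_append_nth[of js N "\<lambda>_ x. x" j] by (simp add: compositions_def)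
  with js show "xs \<in> (\<lambda>(j, js). js @ [j]) ` (SIGMA j:{..k}. compositions N (k - j))"
    by (auto simp: compositions_def)
next
  fix xs assume "xs \<in> (\<lambda>(j, js). js @ [j]) ` (SIGMA j:{..k}. compositions N (k - j))"
  then obtain j js where js: "xs = js @ [j]" "j \<le> k" "length js = N" "(\<Sum>l = 1..N. js ! (l - 1)) = k - j"
    by (auto simp: compositions_def)
  then show "xs \<in> compositions (Suc N) k"
    using sum_append_nth[of js N "\<lambda>_ x. x" j] by (simp add: compositions_def)
qed

lemma finite_compositions: "finite (compositions N k)"
  by (induction N arbitrary: k) (auto simp: compositions_0 compositions_Suc)

text \<open>Induction on the number of summands: the binomial theorem separates the last one, whose
  exponent j becomes the last member of the list. Power series are used because the variable t has
  to be tracked in each term.\<close>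

lemma multinomial:
  fixes a :: "nat \<Rightarrow> 'a::field_char_0 fps"
  shows "(\<Sum>l = 1..N. a l) ^ k =
    (\<Sum>js\<in>compositions N k. fps_const (fact k / (\<Prod>l = 1..N. fact (js ! (l - 1)))) *
       (\<Prod>l = 1..N. a l ^ (js ! (l - 1))))"
proof (induction N arbitrary: k)
  case 0
  show ?case by (simp add: compositions_0 zero_power)
next
  case (Suc N)
  let ?t = "\<lambda>N k js. fps_const (fact k / (\<Prod>l = 1..N. fact (js ! (l - 1)))) * (\<Prod>l = 1..N. a l ^ (js ! (l - 1)))"
  have "(\<Sum>l = 1..Suc N. a l) ^ k = (a (Suc N) + (\<Sum>l = 1..N. a l)) ^ k"
    by (simp add: add.commute)
  also have "\<dots> = (\<Sum>j\<le>k. \<Sum>js\<in>compositions N (k - j). of_nat (k choose j) * a (Suc N) ^ j * ?t N (k - j) js)"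
    by (simp only: binomial_ring Suc sum_distrib_left)
  also have "\<dots> = (\<Sum>j\<le>k. \<Sum>js\<in>compositions N (k - j). ?t (Suc N) k (js @ [j]))"
  proof (intro sum.cong refl)
    fix j js assume j: "j \<in> {..k}" and js: "js \<in> compositions N (k - j)"
    then have l: "length js = N" by (simp add: compositions_def)
    \<comment> \<open>The factor k choose j turns the multinomial coefficient for k - j into the one
      for k with the extra part j.\<close>
    have c: "fact k / (P * fact j) = of_nat (k choose j) * (fact (k - j) / P)" for P :: 'a
      using j by (simp add: binomial_fact field_simps)
    show "of_nat (k choose j) * a (Suc N) ^ j * ?t N (k - j) js = ?t (Suc N) k (js @ [j])"
      unfolding prod_append_nth[OF l, of "\<lambda>_ x. fact x"] prod_append_nth[OF l, of "\<lambda>l x. a l ^ x"] c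
      by (simp add: mult_ac fps_of_nat[symmetric] flip: fps_const_mult)
  qed
  also have "\<dots> = (\<Sum>p\<in>(SIGMA j:{..k}. compositions N (k - j)). ?t (Suc N) k (case p of (j, js) \<Rightarrow> js @ [j]))"
    by (subst sum.Sigma) (auto simp: finite_compositions case_prod_beta)
  also have "\<dots> = (\<Sum>js\<in>compositions (Suc N) k. ?t (Suc N) k js)"
    unfolding compositions_Suc by (subst sum.reindex) (auto simp: inj_on_def)
  finally show ?case .
qed

section \<open>Generating functions of scalar Bell polynomials\<close>

text \<open>The constant term is zero whatever \<open>y 0\<close> is: the Bell polynomials involve
  only derivatives of order at least 1, and the k-th power must have order at least k.\<close>

definition egf :: "(nat \<Rightarrow> real) \<Rightarrow> real fps" where
  "egf y = Abs_fps (\<lambda>l. if l = 0 then 0 else y l / fact l)"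

text \<open>The classical partial Bell polynomial, read off from Y^k / k! = \<Sum> B_{n,k} t^n / n!.
  This form includes the conventions for k = 0 and k > n without case distinctions.\<close>

definition scalar_bell :: "(nat \<Rightarrow> real) \<Rightarrow> nat \<Rightarrow> nat \<Rightarrow> real" where
  "scalar_bell y n k = fact n / fact k * fps_nth (egf y ^ k) n"

lemma egf_power_nth_less: "n < k \<Longrightarrow> fps_nth (egf y ^ k) n = 0"
  using startsby_zero_power_prefix[of "egf y" k] by (simp add: egf_def)

text \<open>A product of \<open>k\<close> series without constant term uses only their terms of degree at most
  \<open>n - k + 1\<close> in degree \<open>n\<close>.\<close>

lemma egf_power_nth_truncate:
  assumes "n < N + k"
  shows "fps_nth ((\<Sum>l = 1..N. fps_const (y l / fact l) * fps_X ^ l) ^ k) n = fps_nth (egf y ^ k) n"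
  using assms
proof (induction k arbitrary: n)
  case (Suc k)
  define P where "P = (\<Sum>l = 1..N. fps_const (y l / fact l) * fps_X ^ l)"
  have P: "fps_nth P i = (if 1 \<le> i \<and> i \<le> N then y i / fact i else 0)" for i
    by (simp add: P_def fps_sum_nth if_distrib sum.delta cong: if_cong)
  \<comment> \<open>The Cauchy products agree term by term. For i = 0 both first factors vanish; for
    1 \<le> i \<le> N they are equal and the induction hypothesis applies; for i > N the first
    factor on the left vanishes, and n - i < k makes the second factor on the right vanish.\<close>
  have "fps_nth P i * fps_nth (P ^ k) (n - i) = fps_nth (egf y) i * fps_nth (egf y ^ k) (n - i)"
    if "i \<le> n" for i
  proof (cases "i = 0")
    case False
    then have "n - i < N + k" using Suc.prems that by auto
    then have IH: "fps_nth (P ^ k) (n - i) = fps_nth (egf y ^ k) (n - i)"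
      using Suc.IH P_def by simp
    show ?thesis
    proof (cases "i \<le> N")
      case False
      then have "n - i < k" using Suc.prems that by auto
      then show ?thesis using IH by (simp add: egf_power_nth_less)
    qed (use IH \<open>i \<noteq> 0\<close> P in \<open>simp add: egf_def\<close>)
  qed (simp add: P egf_def)
  then show ?case
    unfolding P_def[symmetric] power_Suc fps_mult_nth by (intro sum.cong) auto
qed simp

text \<open>Apply the multinomial theorem to the truncated series. The exponent of t in the term of
  \<open>js\<close> is the weighted sum of its members, so the n-th coefficient selects the
  sequences with that sum equal to n. The k! of the multinomial coefficient cancels against the one
  in \<open>scalar_bell\<close>.\<close>

lemma scalar_bell_eq_sum:
  assumes "n < N + k"
  shows "scalar_bell y n k =
    (\<Sum>js | length js = N \<and> (\<Sum>l = 1..N. js ! (l - 1)) = k \<and> (\<Sum>l = 1..N. l * js ! (l - 1)) = n.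
      fact n / (\<Prod>l = 1..N. fact (js ! (l - 1))) * (\<Prod>l = 1..N. (y l / fact l) ^ (js ! (l - 1))))"
proof -
  let ?w = "\<lambda>js. \<Sum>l = 1..N. l * js ! (l - 1)"
  let ?t = "\<lambda>js. (\<Prod>l = 1..N. (y l / fact l) ^ (js ! (l - 1)))"
  let ?f = "\<lambda>js. (\<Prod>l = 1..N. fact (js ! (l - 1))) :: real"
  have m: "(\<Prod>l = 1..N. (fps_const (y l / fact l) * fps_X ^ l) ^ (js ! (l - 1))) = fps_const (?t js) * fps_X ^ ?w js" for js
    by (induction N) (simp_all add: power_mult_distrib power_mult[symmetric] power_add fps_const_power mult_ac
      flip: fps_const_mult)
  have "fps_nth (egf y ^ k) n =
     (\<Sum>js\<in>compositions N k. fps_nth (fps_const (fact k / ?f js) * (fps_const (?t js) * fps_X ^ ?w js)) n)"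
    by (simp only: egf_power_nth_truncate[OF assms, symmetric] multinomial m fps_sum_nth)
  also have "\<dots> = (\<Sum>js\<in>compositions N k. if ?w js = n then fact k / ?f js * ?t js else 0)"
    by (intro sum.cong refl) auto
  also have "\<dots> = (\<Sum>js\<in>{js\<in>compositions N k. ?w js = n}. fact k / ?f js * ?t js)"
    by (rule sum.inter_filter[symmetric, OF finite_compositions])
  finally show ?thesis
    by (simp add: scalar_bell_def sum_distrib_left compositions_def conj_assoc)
qed

lemma fact_ratio_binomial: "i \<le> n \<Longrightarrow> fact n / (fact (n - i) * fact i) = real (n choose i)"
  by (simp add: binomial_fact field_simps)

text \<open>The n-th coefficient of Y^k times an exponential generating function: the factorials of
  the Cauchy product combine into binomial coefficients, and terms with i > n - k vanish because Y^k
  has order at least k. It serves both recurrences (i) and (ii).\<close>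

lemma scalar_bell_convolution:
  "fact n / fact k * fps_nth (egf y ^ k * Abs_fps (\<lambda>i. z i / fact i)) n =
    (\<Sum>i\<le>n - k. real (n choose i) * (scalar_bell y (n - i) k * z i))"
proof -
  have "fact n / fact k * fps_nth (egf y ^ k * Abs_fps (\<lambda>i. z i / fact i)) n =
     (\<Sum>i\<le>n. fact n / fact k * (fps_nth (egf y ^ k) (n - i) * (z i / fact i)))"
    by (subst mult.commute[of "egf y ^ k"]) (simp only: fps_mult_nth sum_distrib_left atLeast0AtMost, simp add: mult_ac)
  also have "\<dots> = (\<Sum>i\<le>n. real (n choose i) * (scalar_bell y (n - i) k * z i))"
    by (intro sum.cong refl) (auto simp: scalar_bell_def fact_ratio_binomial[symmetric])
  also have "\<dots> = (\<Sum>i\<le>n - k. real (n choose i) * (scalar_bell y (n - i) k * z i))"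
  proof (cases "k \<le> n")
    case True
    then show ?thesis
      by (intro sum.mono_neutral_right) (auto simp: scalar_bell_def egf_power_nth_less)
  next
    \<comment> \<open>For k > n truncated subtraction leaves the range {0} instead of an empty one,
      but every Bell factor vanishes.\<close>
    case False
    have "scalar_bell y m k = 0" if "m \<le> n" for m
      using False that by (simp add: scalar_bell_def egf_power_nth_less)
    then show ?thesis by simp
  qed
  finally show ?thesis .
qed

text \<open>Compare the coefficients of t^(n-1) in (Y^k)' = k Y^(k-1) Y'. The coefficients of Y'
  belong to the shifted sequence, hence n - 1 and i - 1 in the binomial coefficient. With the bound
  written \<open>n + 1 - k\<close> the range is empty for k > n, where the left side is zero
  too.\<close>

lemma scalar_bell_rec:
  assumes "1 \<le> n" "1 \<le> k"
  shows "scalar_bell y n k =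
    (\<Sum>i = 1..n + 1 - k. real ((n - 1) choose (i - 1)) * (scalar_bell y (n - i) (k - 1) * y i))"
proof -
  obtain m j where mj: "n = Suc m" "k = Suc j"
    using assms by (metis Suc_diff_1 less_eq_Suc_le One_nat_def)
  have d: "fps_deriv (egf y) = Abs_fps (\<lambda>i. y (Suc i) / fact i)"
    by (rule fps_ext) (simp add: egf_def del: of_nat_Suc)
  have "real (Suc m) * fps_nth (egf y ^ Suc j) (Suc m) = fps_nth (fps_deriv (egf y ^ Suc j)) m"
    by (simp only: fps_deriv_nth Suc_eq_plus1)
  also have "fps_deriv (egf y ^ Suc j) = fps_const (real (Suc j)) * (egf y ^ j * fps_deriv (egf y))"
    by (simp only: fps_deriv_power diff_Suc_1 mult_ac)
  finally have "real (Suc m) * fps_nth (egf y ^ Suc j) (Suc m) =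
      real (Suc j) * fps_nth (egf y ^ j * fps_deriv (egf y)) m"
    by (simp only: fps_mult_left_const_nth)
  moreover have "scalar_bell y n k = fact m / fact j * (real (Suc m) * fps_nth (egf y ^ Suc j) (Suc m) / real (Suc j))"
    by (simp add: scalar_bell_def mj mult_ac del: of_nat_Suc power_Suc)
  ultimately have "scalar_bell y n k = fact m / fact j * fps_nth (egf y ^ j * fps_deriv (egf y)) m"
    by (simp del: of_nat_Suc power_Suc)
  also have "\<dots> = (\<Sum>i\<le>m - j. real (m choose i) * (scalar_bell y (m - i) j * y (Suc i)))"
    unfolding d by (rule scalar_bell_convolution)
  also have "\<dots> = (\<Sum>i = 1..n + 1 - k. real ((n - 1) choose (i - 1)) * (scalar_bell y (n - i) (k - 1) * y i))"
    if "j \<le> m"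
    using that by (intro sum.reindex_bij_witness[where i = "\<lambda>i. i - 1" and j = Suc]) (auto simp: mj)
  finally show ?thesis
    by (cases "j \<le> m") (auto simp: scalar_bell_def mj egf_power_nth_less simp del: power_Suc)
qed

section \<open>Power series depending on a parameter\<close>

text \<open>The power rule, coefficient by coefficient, from the product rule in each Cauchy
  product. The n-th coefficient of a power depends only on coefficients up to n, so only those must
  be differentiable; this matters because g has finitely many derivatives.\<close>

lemma fps_nth_power_has_real_derivative:
  fixes F :: "real \<Rightarrow> real fps"
  assumes "\<And>m. m \<le> n \<Longrightarrow> ((\<lambda>s. fps_nth (F s) m) has_real_derivative fps_nth G m) (at t)"
  shows "((\<lambda>s. fps_nth (F s ^ k) n) has_real_derivative
    real k * fps_nth (F t ^ (k - 1) * G) n) (at t)"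
  using assms
proof (induction k arbitrary: n)
  case (Suc k)
  have IH: "((\<lambda>s. fps_nth (F s ^ k) m) has_real_derivative
    real k * fps_nth (F t ^ (k - 1) * G) m) (at t)" if "m \<le> n" for m
    using that by (intro Suc) auto
  have "((\<lambda>s. \<Sum>i = 0..n. fps_nth (F s) i * fps_nth (F s ^ k) (n - i)) has_real_derivative
     (\<Sum>i = 0..n. fps_nth G i * fps_nth (F t ^ k) (n - i) +
       real k * fps_nth (F t ^ (k - 1) * G) (n - i) * fps_nth (F t) i)) (at t)"
    by (intro DERIV_sum DERIV_mult IH Suc.prems) auto
  also have "(\<Sum>i = 0..n. fps_nth G i * fps_nth (F t ^ k) (n - i) +
       real k * fps_nth A (n - i) * fps_nth (F t) i) =
     fps_nth (G * F t ^ k + fps_const (real k) * (F t * A)) n" for A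
    unfolding fps_add_nth fps_mult_left_const_nth fps_mult_nth[of G] fps_mult_nth[of "F t"]
    by (simp add: sum.distrib sum_distrib_left mult_ac)
  \<comment> \<open>For k = 0 the truncated \<open>k - 1\<close> is harmless because its term
    carries the factor k.\<close>
  also have "G * F t ^ k + fps_const (real k) * (F t * (F t ^ (k - 1) * G)) =
     fps_const (real (Suc k)) * (F t ^ k * G)"
    by (cases k) (simp_all add: algebra_simps flip: fps_const_add)
  finally show ?case by (simp add: fps_mult_nth[of "F _"] del: of_nat_Suc)
qed simp

lemma scalar_bell_has_real_derivative:
  assumes deriv: "\<And>l. 1 \<le> l \<Longrightarrow> l \<le> n \<Longrightarrow> ((\<lambda>s. y s l) has_real_derivative y t (l + 1)) (at t)"
    and "1 \<le> k"
  shows "((\<lambda>s. scalar_bell (y s) n k) has_real_derivative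
    (\<Sum>i = 1..n + 1 - k. real (n choose i) * (scalar_bell (y t) (n - i) (k - 1) * y t (i + 1)))) (at t)"
proof -
  obtain j where j: "k = Suc j" using \<open>1 \<le> k\<close> by (cases k) auto
  \<comment> \<open>The derivative of the series has constant term zero, since the constant term of
    \<open>egf\<close> does not vary. This is why the final sum starts at i = 1.\<close>
  define z where "z i = (if i = 0 then 0 else y t (i + 1))" for i
  have "((\<lambda>s. fps_nth (egf (y s)) m) has_real_derivative fps_nth (Abs_fps (\<lambda>i. z i / fact i)) m) (at t)"
    if "m \<le> n" for m
    using deriv[of m] that by (cases "m = 0") (auto simp: egf_def z_def intro: DERIV_cdivide)
  from fps_nth_power_has_real_derivative[OF this, where k = k]
  have "((\<lambda>s. scalar_bell (y s) n k) has_real_derivative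
     fact n / fact k * (real k * fps_nth (egf (y t) ^ (k - 1) * Abs_fps (\<lambda>i. z i / fact i)) n)) (at t)"
    unfolding scalar_bell_def by (intro DERIV_cmult) auto
  also have "fact n / fact k * (real k * fps_nth (egf (y t) ^ (k - 1) * Abs_fps (\<lambda>i. z i / fact i)) n) =
     fact n / fact j * fps_nth (egf (y t) ^ j * Abs_fps (\<lambda>i. z i / fact i)) n"
    by (simp add: j del: of_nat_Suc)
  also have "\<dots> = (\<Sum>i\<le>n - j. real (n choose i) * (scalar_bell (y t) (n - i) j * z i))"
    by (rule scalar_bell_convolution)
  also have "\<dots> = (\<Sum>i = 1..n + 1 - k. real (n choose i) * (scalar_bell (y t) (n - i) (k - 1) * y t (i + 1)))"
    by (intro sum.mono_neutral_cong_right) (auto simp: j z_def)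
  finally show ?thesis .
qed

section \<open>Matrix derivatives\<close>

lemma frechet_derivative_cong_open:
  fixes f f' :: "'v::euclidean_space \<Rightarrow> 'w::euclidean_space"
  assumes "open U" "x \<in> U" "\<And>x. x \<in> U \<Longrightarrow> f x = f' x"
  shows "frechet_derivative f (at x) = frechet_derivative f' (at x)"
    and "f differentiable (at x) \<longleftrightarrow> f' differentiable (at x)"
proof -
  have "(f has_derivative h) (at x) \<longleftrightarrow> (f' has_derivative h) (at x)" for h
    using assms by (metis has_derivative_transform_within_open)
  then show "frechet_derivative f (at x) = frechet_derivative f' (at x)"
    and "f differentiable (at x) \<longleftrightarrow> f' differentiable (at x)"
    by (simp_all add: frechet_derivative_def differentiable_def)
qed

text \<open>The recursion differentiates total functions, while formulas for derivatives hold only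
  on U. Openness of U allows them to be substituted there.\<close>

lemma times_differentiable_on_cong:
  assumes "open U" "\<And>x. x \<in> U \<Longrightarrow> f x = f' x"
  shows "times_differentiable_on n f U \<longleftrightarrow> times_differentiable_on n f' U"
  using assms(2)
proof (induction n arbitrary: f f')
  case (Suc n)
  have "times_differentiable_on n (\<lambda>x. frechet_derivative f (at x) v) U \<longleftrightarrow>
    times_differentiable_on n (\<lambda>x. frechet_derivative f' (at x) v) U" for v
    by (rule Suc.IH) (use frechet_derivative_cong_open(1)[OF \<open>open U\<close> _ Suc.prems] in simp)
  then show ?case
    using frechet_derivative_cong_open(2)[OF \<open>open U\<close> _ Suc.prems] by simp
qed simp

text \<open>A bounded linear map commutes with differentiation. Applied to coordinate projections,
  this passes from g to its components.\<close>

lemma times_differentiable_on_bounded_linear: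
  fixes f :: "'v::euclidean_space \<Rightarrow> 'w::euclidean_space" and L :: "'w \<Rightarrow> 'u::euclidean_space"
  assumes "open U" "bounded_linear L" "times_differentiable_on n f U"
  shows "times_differentiable_on n (\<lambda>x. L (f x)) U"
  using assms(3)
proof (induction n arbitrary: f)
  case (Suc n)
  have d: "((\<lambda>x. L (f x)) has_derivative (\<lambda>v. L (frechet_derivative f (at x) v))) (at x)" if "x \<in> U" for x
    using Suc.prems that
    by (intro bounded_linear.has_derivative[OF assms(2)]) (simp add: frechet_derivative_works)
  have "times_differentiable_on n (\<lambda>x. frechet_derivative (\<lambda>x. L (f x)) (at x) v) U" for v
  proof -
    have "times_differentiable_on n (\<lambda>x. L (frechet_derivative f (at x) v)) U"
      using Suc by simp
    then show ?thesis
      by (subst times_differentiable_on_cong[OF \<open>open U\<close>, where f' = "\<lambda>x. L (frechet_derivative f (at x) v)"])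
        (use frechet_derivative_at[OF d, symmetric] in auto)
  qed
  then show ?case using d by (auto simp: differentiable_def)
qed simp

lemma times_differentiable_on_mono:
  "times_differentiable_on n f U \<Longrightarrow> m \<le> n \<Longrightarrow> times_differentiable_on m f U"
proof (induction n arbitrary: f m)
  case (Suc n)
  then show ?case by (cases m) auto
qed simp

text \<open>The chain rule along a line. It links the one-variable derivative in
  \<open>partial\<close>, and later the direction X, to the Frechet derivative.\<close>

lemma has_derivative_along_line:
  fixes f :: "'v::real_normed_vector \<Rightarrow> real"
  assumes "f differentiable (at x)"
  shows "((\<lambda>t. f (x + t *\<^sub>R v)) has_real_derivative frechet_derivative f (at x) v) (at 0)"
proof -
  have f: "(f has_derivative frechet_derivative f (at x)) (at (x + 0 *\<^sub>R v))"
    using assms by (simp add: frechet_derivative_works)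
  have "((\<lambda>t. x + t *\<^sub>R v) has_derivative (\<lambda>t. t *\<^sub>R v)) (at 0)"
    by (auto intro!: derivative_eq_intros)
  from has_derivative_compose[OF this f]
  have "((\<lambda>t. f (x + t *\<^sub>R v)) has_derivative (\<lambda>t. frechet_derivative f (at x) (t *\<^sub>R v))) (at 0)" .
  then show ?thesis
    using linear_frechet_derivative[OF assms]
    by (simp add: has_field_derivative_def linear_cmul mult_commute_abs)
qed

lemma partial_eq_frechet_derivative:
  "f differentiable (at x) \<Longrightarrow> partial a f x = frechet_derivative f (at x) (axis a 1)"
  unfolding partial_def by (intro DERIV_imp_deriv has_derivative_along_line)

lemma mat_deriv_carrier [simp]:
  fixes x :: "real ^ 'a::{finite,linorder}"
  shows "F x \<in> carrier_mat r c \<Longrightarrow> mat_deriv F x \<in> carrier_mat r (c * CARD('a))"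
  by (auto simp: mat_deriv_def)

lemma nth_mat_deriv_carrier [simp]:
  fixes g :: "real ^ 'a::{finite,linorder} \<Rightarrow> real ^ 'b::{finite,linorder}"
  shows "nth_mat_deriv g l x \<in> carrier_mat CARD('b) (CARD('a) ^ l)"
proof (induction l arbitrary: x)
  case 0
  show ?case by (simp add: nth_mat_deriv_def column_def)
next
  case (Suc l)
  have "nth_mat_deriv g (Suc l) x = mat_deriv (nth_mat_deriv g l) x"
    by (simp add: nth_mat_deriv_def)
  with mat_deriv_carrier[OF Suc] show ?case by (simp add: mult.commute)
qed

text \<open>Each order of the matrix derivative uses up one order of differentiability, so the
  induction on l keeps n general. Column j at order \<open>Suc l\<close> comes from column
  \<open>j div CARD('a)\<close> at order l, differentiated along coordinate
  \<open>j mod CARD('a)\<close>.\<close>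

lemma times_differentiable_on_nth_mat_deriv:
  fixes g :: "real ^ 'a::{finite,linorder} \<Rightarrow> real ^ 'b::{finite,linorder}"
  assumes "open U" "times_differentiable_on (n + l) g U" "i < CARD('b)" "j < CARD('a) ^ l"
  shows "times_differentiable_on n (\<lambda>x. nth_mat_deriv g l x $$ (i, j)) U"
  using assms(2,4)
proof (induction l arbitrary: n j)
  case 0
  then show ?case
    using times_differentiable_on_bounded_linear[OF \<open>open U\<close> bounded_linear_vec_nth] assms(3)
    by (simp add: nth_mat_deriv_def column_def)
next
  case (Suc l)
  define f where "f = (\<lambda>x. nth_mat_deriv g l x $$ (i, j div CARD('a)))"
  let ?e = "axis (idx (j mod CARD('a))) 1 :: real ^ 'a::{finite,linorder}"
  have "j < CARD('a) ^ l * CARD('a)" using Suc.prems by (simp add: mult.commute)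
  then have "times_differentiable_on (Suc n) f U"
    unfolding f_def using Suc.prems div_mod_less_mult by (intro Suc.IH) auto
  then have f: "\<And>x. x \<in> U \<Longrightarrow> f differentiable (at x)"
    and f': "times_differentiable_on n (\<lambda>x. frechet_derivative f (at x) ?e) U"
    by auto
  have "nth_mat_deriv g (Suc l) x $$ (i, j) = frechet_derivative f (at x) ?e" if "x \<in> U" for x
  proof -
    have "nth_mat_deriv g (Suc l) x = mat_deriv (nth_mat_deriv g l) x"
      by (simp add: nth_mat_deriv_def)
    then show ?thesis
      using \<open>i < CARD('b)\<close> \<open>j < CARD('a) ^ l * CARD('a)\<close> carrier_matD[OF nth_mat_deriv_carrier[of g l x]]
        partial_eq_frechet_derivative[OF f[OF that]]
      by (simp add: mat_deriv_def f_def)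
  qed
  then show ?case
    by (subst times_differentiable_on_cong[OF \<open>open U\<close>, where f' = "\<lambda>x. frechet_derivative f (at x) ?e"])
      (use f' in auto)
qed

section \<open>Entrywise differentiability of matrix functions\<close>

text \<open>The size is fixed at every point, not only at x, because the entry formulas of products
  are used as equalities of functions of y.\<close>

definition mat_differentiable ::
  "nat \<Rightarrow> nat \<Rightarrow> ('v::real_normed_vector \<Rightarrow> real mat) \<Rightarrow> 'v \<Rightarrow> bool" where
  "mat_differentiable r c F x \<longleftrightarrow> (\<forall>y. F y \<in> carrier_mat r c) \<and>
     (\<forall>i<r. \<forall>j<c. (\<lambda>y. F y $$ (i, j)) differentiable (at x))"

lemma mat_differentiable_const: "A \<in> carrier_mat r c \<Longrightarrow> mat_differentiable r c (\<lambda>_. A) x"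
  by (auto simp: mat_differentiable_def)

lemma mat_differentiable_smult:
  assumes "mat_differentiable r c F x"
  shows "mat_differentiable r c (\<lambda>y. a \<cdot>\<^sub>m F y) x"
proof -
  have "(\<lambda>y. (a \<cdot>\<^sub>m F y) $$ (i, j)) = (\<lambda>y. a * F y $$ (i, j))" if "i < r" "j < c" for i j
    using assms that by (intro ext) (auto simp: mat_differentiable_def intro!: index_smult_mat(1))
  then show ?thesis
    using assms by (auto simp: mat_differentiable_def)
qed

lemma mat_differentiable_kronecker:
  assumes "mat_differentiable r c F x" "mat_differentiable r' c' G x"
  shows "mat_differentiable (r * r') (c * c') (\<lambda>y. F y \<otimes>\<^sub>K G y) x"
proof -
  have "(\<lambda>y. (F y \<otimes>\<^sub>K G y) $$ (i, j)) = (\<lambda>y. F y $$ (i div r', j div c') * G y $$ (i mod r', j mod c'))"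
    if "i < r * r'" "j < c * c'" for i j
  proof (intro ext)
    fix y
    have "F y \<in> carrier_mat r c" "G y \<in> carrier_mat r' c'"
      using assms by (auto simp: mat_differentiable_def)
    then show "(F y \<otimes>\<^sub>K G y) $$ (i, j) = F y $$ (i div r', j div c') * G y $$ (i mod r', j mod c')"
      using that by (auto simp: index_kronecker)
  qed
  then show ?thesis
    using assms by (auto simp: mat_differentiable_def div_mod_less_mult)
qed

lemma mat_differentiable_kronecker_power:
  assumes "mat_differentiable r c F x"
  shows "mat_differentiable (r ^ m) (c ^ m) (\<lambda>y. kronecker_power (F y) m) x"
proof (induction m)
  case 0
  show ?case by (simp add: mat_differentiable_const)
next
  case (Suc m)
  from mat_differentiable_kronecker[OF this assms] show ?case by (simp add: mult.commute)
qed

lemma mat_differentiable_kronecker_list: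
  assumes "\<And>l. l \<in> set ls \<Longrightarrow> mat_differentiable (r l) (c l) (F l) x"
  shows "mat_differentiable (prod_list (map r ls)) (prod_list (map c ls))
    (\<lambda>y. kronecker_list (map (\<lambda>l. F l y) ls)) x"
  using assms
proof (induction ls rule: rev_induct)
  case Nil
  show ?case by (simp add: kronecker_list_def mat_differentiable_const)
next
  case (snoc l ls)
  have "mat_differentiable (prod_list (map r ls) * r l) (prod_list (map c ls) * c l)
     (\<lambda>y. kronecker_list (map (\<lambda>l. F l y) ls) \<otimes>\<^sub>K F l y) x"
    by (intro mat_differentiable_kronecker snoc) auto
  then show ?case by (simp add: kronecker_list_def)
qed

lemma mat_differentiable_mat_sum:
  assumes "\<And>h. h \<in> I \<Longrightarrow> mat_differentiable r c (F h) x" and "finite I"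
  shows "mat_differentiable r c (\<lambda>y. mat_sum r c (\<lambda>h. F h y) I) x"
  using assms by (auto simp: mat_differentiable_def mat_sum_def intro!: differentiable_sum)

text \<open>The derivative is the last Kronecker factor, so contracting \<open>\<partial>F/\<partial>x'\<close> with one more
  factor \<open>X\<close> is differentiating along \<open>X\<close>.\<close>

lemma contract_mat_deriv:
  fixes F :: "real ^ 'a::{finite,linorder} \<Rightarrow> real mat"
  assumes D: "D \<in> carrier_mat 1 b"
    and F: "mat_differentiable (b ^ k) (CARD('a) ^ n) F x"
  shows "((\<lambda>t. contract D (column v) k n (F (x + t *\<^sub>R v))) has_real_derivative
    contract D (column v) k (n + 1) (mat_deriv F x)) (at 0)"
proof -
  let ?a = "CARD('a)"
  have X: "column v \<in> carrier_mat ?a 1" by (simp add: column_def)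
  have carrier: "\<And>y. F y \<in> carrier_mat (b ^ k) (?a ^ n)"
    and diff: "\<And>i j. i < b ^ k \<Longrightarrow> j < ?a ^ n \<Longrightarrow> (\<lambda>y. F y $$ (i, j)) differentiable (at x)"
    using F by (auto simp: mat_differentiable_def)
  let ?w = "\<lambda>i j. kronecker_power D k $$ (0, i) * kronecker_power (column v) n $$ (j, 0)"
  let ?f' = "\<lambda>i j. frechet_derivative (\<lambda>y. F y $$ (i, j)) (at x)"
  \<comment> \<open>The unit vectors are listed through \<open>idx\<close>, so that q is also the
    position of the partial derivative inside a row of \<open>mat_deriv\<close>.\<close>
  have v: "v = (\<Sum>q<?a. (vec_nth v (idx q)) *\<^sub>R axis (idx q) 1)"
  proof -
    have "v = (\<Sum>a\<in>UNIV. vec_nth v a *\<^sub>R axis a 1)"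
      using basis_expansion[of v] by (simp add: scalar_mult_eq_scaleR)
    also have "\<dots> = (\<Sum>q<?a. (vec_nth v (idx q)) *\<^sub>R axis (idx q) 1)"
      by (rule sum.reindex_bij_betw[OF bij_betw_idx, symmetric])
    finally show ?thesis .
  qed
  have dir: "?f' i j v = (\<Sum>q<?a. vec_nth v (idx q) * ?f' i j (axis (idx q) 1))"
    if "i < b ^ k" "j < ?a ^ n" for i j
    by (subst v) (use linear_frechet_derivative[OF diff[OF that]] in \<open>simp add: linear_sum linear_cmul\<close>)
  have "contract D (column v) k (n + 1) (mat_deriv F x) =
    (\<Sum>i<b ^ k. \<Sum>h<?a ^ n * ?a. kronecker_power D k $$ (0, i) *
       kronecker_power (column v) (n + 1) $$ (h, 0) * mat_deriv F x $$ (i, h))"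
    using contract_sum[OF D X, of "mat_deriv F x" k "n + 1"] mat_deriv_carrier[of F x, OF carrier]
    by (simp add: mult.commute[of "?a"])
  \<comment> \<open>Column h of the derivative encodes a column of F and a direction. The last
    factor of X_{n+1} supplies the coordinate of v for that direction, so summing over directions
    rebuilds the derivative along v.\<close>
  also have "\<dots> = (\<Sum>i<b ^ k. \<Sum>h<?a ^ n * ?a. ?w i (h div ?a) * vec_nth v (idx (h mod ?a)) *
       ?f' i (h div ?a) (axis (idx (h mod ?a)) 1))"
  proof (intro sum.cong refl)
    fix i h assume "i \<in> {..<b ^ k}" "h \<in> {..<?a ^ n * ?a}"
    then have i: "i < b ^ k" and h: "h < ?a ^ n * ?a" by auto
    note h' = div_mod_less_mult[OF h]
    have "kronecker_power (column v) (n + 1) $$ (h, 0) =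
        kronecker_power (column v) n $$ (h div ?a, 0) * vec_nth v (idx (h mod ?a))"
      using h h' carrier_matD[OF kronecker_power_column[OF X, of n]] carrier_matD[OF X]
      by (simp add: index_kronecker) (simp add: column_def)
    moreover have "mat_deriv F x $$ (i, h) = ?f' i (h div ?a) (axis (idx (h mod ?a)) 1)"
      using i h carrier_matD[OF carrier[of x]] partial_eq_frechet_derivative[OF diff[OF i h'(1)]]
      by (simp add: mat_deriv_def)
    ultimately show "kronecker_power D k $$ (0, i) *
       kronecker_power (column v) (n + 1) $$ (h, 0) * mat_deriv F x $$ (i, h) =
       ?w i (h div ?a) * vec_nth v (idx (h mod ?a)) * ?f' i (h div ?a) (axis (idx (h mod ?a)) 1)"
      by simp
  qed
  also have "\<dots> = (\<Sum>i<b ^ k. \<Sum>j<?a ^ n. \<Sum>q<?a. ?w i j * vec_nth v (idx q) * ?f' i j (axis (idx q) 1))"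
    by (intro sum.cong refl sum_lessThan_mult)
  also have "\<dots> = (\<Sum>i<b ^ k. \<Sum>j<?a ^ n. ?w i j * ?f' i j v)"
    by (intro sum.cong refl) (simp add: dir sum_distrib_left mult_ac)
  finally have eq: "contract D (column v) k (n + 1) (mat_deriv F x) =
    (\<Sum>i<b ^ k. \<Sum>j<?a ^ n. ?w i j * ?f' i j v)" .
  have "((\<lambda>t. \<Sum>i<b ^ k. \<Sum>j<?a ^ n. ?w i j * F (x + t *\<^sub>R v) $$ (i, j)) has_real_derivative
     (\<Sum>i<b ^ k. \<Sum>j<?a ^ n. ?w i j * ?f' i j v)) (at 0)"
    by (intro DERIV_sum DERIV_cmult has_derivative_along_line diff) auto
  then show ?thesis
    unfolding eq using contract_sum[OF D X carrier] by simp
qed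

section \<open>Bell matrices\<close>

lemma bell_carrier [simp]:
  fixes g :: "real ^ 'a::{finite,linorder} \<Rightarrow> real ^ 'b::{finite,linorder}"
  shows "bell g n k x \<in> carrier_mat (CARD('b) ^ k) (CARD('a) ^ n)"
  by (auto simp: bell_def mat_sum_def)

lemma bell_eq_mat_sum:
  fixes g :: "real ^ 'a::{finite,linorder} \<Rightarrow> real ^ 'b::{finite,linorder}"
  assumes "1 \<le> k" "k \<le> n"
  defines "N \<equiv> n - k + 1"
  shows "bell g n k x = mat_sum (CARD('b) ^ k) (CARD('a) ^ n)
    (\<lambda>js. (fact n / (\<Prod>l = 1..N. fact (js ! (l - 1)))) \<cdot>\<^sub>m
       kronecker_list (map (\<lambda>l. kronecker_power ((1 / fact l) \<cdot>\<^sub>m nth_mat_deriv g l x) (js ! (l - 1))) [1..<N + 1]))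
    {js. length js = N \<and> (\<Sum>l = 1..N. js ! (l - 1)) = k \<and> (\<Sum>l = 1..N. l * js ! (l - 1)) = n}"
  using assms by (simp add: bell_def bell_seqs_def)

text \<open>For 1 \<le> k \<le> n each Kronecker monomial contracts to a product of powers of y_l /
  l!, and the sum is that of \<open>scalar_bell_eq_sum\<close> with N = n - k + 1. In the remaining
  cases both sides are 1 for n = k = 0 and 0 otherwise.\<close>

lemma contract_bell:
  fixes g :: "real ^ 'a::{finite,linorder} \<Rightarrow> real ^ 'b::{finite,linorder}"
  assumes D: "D \<in> carrier_mat 1 CARD('b)" and X: "X \<in> carrier_mat CARD('a) 1"
  shows "contract D X k n (bell g n k x) =
    scalar_bell (\<lambda>l. contract D X 1 l (nth_mat_deriv g l x)) n k"
proof (cases "1 \<le> k \<and> k \<le> n")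
  case True
  define N where "N = n - k + 1"
  define A where "A l = (1 / fact l) \<cdot>\<^sub>m nth_mat_deriv g l x" for l
  define S where "S = {js. length js = N \<and> (\<Sum>l = 1..N. js ! (l - 1)) = k \<and> (\<Sum>l = 1..N. l * js ! (l - 1)) = n}"
  have A: "A l \<in> carrier_mat CARD('b) (CARD('a) ^ l)" for l
    by (simp add: A_def)
  have cA: "contract D X 1 l (A l) = contract D X 1 l (nth_mat_deriv g l x) / fact l" for l
    using contract_smult[OF D X, of "nth_mat_deriv g l x" 1 l "1 / fact l"] by (simp add: A_def)
  let ?K = "\<lambda>js. kronecker_list (map (\<lambda>l. kronecker_power (A l) (js ! (l - 1))) [1..<N + 1])"
  have K: "?K js \<in> carrier_mat (CARD('b) ^ k) (CARD('a) ^ n)"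
    "contract D X k n (?K js) = (\<Prod>l = 1..N. contract D X 1 l (A l) ^ (js ! (l - 1)))"
    if "js \<in> S" for js
    using contract_kronecker_list[OF D X A, where N = N and js = js] that by (auto simp: S_def)
  have "contract D X k n (bell g n k x) =
    (\<Sum>js\<in>S. contract D X k n ((fact n / (\<Prod>l = 1..N. fact (js ! (l - 1)))) \<cdot>\<^sub>m ?K js))"
    using True unfolding bell_eq_mat_sum[OF conjunct1[OF True] conjunct2[OF True]] A_def[symmetric] N_def[symmetric] S_def[symmetric]
    by (intro contract_mat_sum[OF D X] smult_carrier_mat K)
  also have "\<dots> = (\<Sum>js\<in>S. fact n / (\<Prod>l = 1..N. fact (js ! (l - 1))) *
      (\<Prod>l = 1..N. contract D X 1 l (A l) ^ (js ! (l - 1))))"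
    by (intro sum.cong refl) (simp only: contract_smult[OF D X K(1)] K(2))
  also have "\<dots> = scalar_bell (\<lambda>l. contract D X 1 l (nth_mat_deriv g l x)) n k"
    unfolding cA S_def by (rule scalar_bell_eq_sum[symmetric]) (use True in \<open>simp add: N_def\<close>)
  finally show ?thesis .
next
  case False
  then show ?thesis
    using contract_one[OF D X] contract_zero[OF D X, of k n]
    by (auto simp: bell_def scalar_bell_def egf_power_nth_less not_le)
qed

text \<open>Allows \<open>contract_mat_deriv\<close> to be applied to the Bell matrix. For 1 \<le> k
  \<le> n only orders l \<le> n - k + 1 \<le> n occur in it, so differentiability of g_{x^l} for l
  \<le> n suffices.\<close>

lemma mat_differentiable_bell:
  fixes g :: "real ^ 'a::{finite,linorder} \<Rightarrow> real ^ 'b::{finite,linorder}"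
  assumes g: "\<And>l. l \<le> n \<Longrightarrow> mat_differentiable CARD('b) (CARD('a) ^ l) (nth_mat_deriv g l) x"
  shows "mat_differentiable (CARD('b) ^ k) (CARD('a) ^ n) (bell g n k) x"
proof (cases "1 \<le> k \<and> k \<le> n")
  case True
  define N where "N = n - k + 1"
  have sum_upt: "sum_list (map f [1..<m + 1]) = (\<Sum>l = 1..m. f l)" for f :: "nat \<Rightarrow> nat" and m
    by (induction m) auto
  \<comment> \<open>Kronecker factors multiply sizes, while the Bell conditions fix sums of
    exponents; this translates between the two.\<close>
  have prod_upt: "prod_list (map (\<lambda>l. c ^ f l) [1..<m + 1]) = c ^ (\<Sum>l = 1..m. f l)" for c and f :: "nat \<Rightarrow> nat" and m
    by (induction m) (auto simp: power_add)
  have "mat_differentiable (CARD('b) ^ (\<Sum>l = 1..N. js ! (l - 1))) (CARD('a) ^ (\<Sum>l = 1..N. l * js ! (l - 1)))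
      (\<lambda>y. kronecker_list (map (\<lambda>l. kronecker_power ((1 / fact l) \<cdot>\<^sub>m nth_mat_deriv g l y) (js ! (l - 1))) [1..<N + 1])) x" for js
    unfolding prod_upt[symmetric] power_mult
    by (intro mat_differentiable_kronecker_list mat_differentiable_kronecker_power mat_differentiable_smult g)
      (use True in \<open>auto simp: N_def\<close>)
  moreover have "finite {js. length js = N \<and> (\<Sum>l = 1..N. js ! (l - 1)) = k \<and> (\<Sum>l = 1..N. l * js ! (l - 1)) = n}"
    using finite_bell_seqs[of n k] by (simp add: bell_seqs_def N_def)
  ultimately show ?thesis
    unfolding bell_eq_mat_sum[OF conjunct1[OF True] conjunct2[OF True], abs_def] N_def[symmetric]
    by (intro mat_differentiable_mat_sum mat_differentiable_smult) auto
next
  case False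
  then have "bell g n k = (\<lambda>_. if n = 0 \<and> k = 0 then 1\<^sub>m 1 else 0\<^sub>m (CARD('b) ^ k) (CARD('a) ^ n))"
    by (auto simp: bell_def fun_eq_iff)
  then show ?thesis by (auto intro!: mat_differentiable_const)
qed

text \<open>Treats the sums in (i) and (ii) together: d is the extra order of the derivative of g, 0
  for (i) and 1 for (ii).\<close>

lemma contract_bell_sum:
  fixes g :: "real ^ 'a::{finite,linorder} \<Rightarrow> real ^ 'b::{finite,linorder}" and c :: "nat \<Rightarrow> real"
    and x :: "real ^ 'a::{finite,linorder}" and d :: nat
  assumes D: "D \<in> carrier_mat 1 CARD('b)" and X: "X \<in> carrier_mat CARD('a) 1"
    and "1 \<le> k" and I: "I \<subseteq> {..n}"
  defines "S \<equiv> mat_sum (CARD('b) ^ k) (CARD('a) ^ (n + d))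
    (\<lambda>i. c i \<cdot>\<^sub>m (bell g (n - i) (k - 1) x \<otimes>\<^sub>K nth_mat_deriv g (i + d) x)) I"
  shows "S \<in> carrier_mat (CARD('b) ^ k) (CARD('a) ^ (n + d))"
    and "contract D X k (n + d) S =
      (\<Sum>i\<in>I. c i * (scalar_bell (\<lambda>l. contract D X 1 l (nth_mat_deriv g l x)) (n - i) (k - 1) *
        contract D X 1 (i + d) (nth_mat_deriv g (i + d) x)))"
proof -
  show "S \<in> carrier_mat (CARD('b) ^ k) (CARD('a) ^ (n + d))"
    by (simp add: S_def mat_sum_def)
  have K: "bell g (n - i) (k - 1) x \<otimes>\<^sub>K nth_mat_deriv g (i + d) x \<in> carrier_mat (CARD('b) ^ k) (CARD('a) ^ (n + d))"
    "contract D X k (n + d) (bell g (n - i) (k - 1) x \<otimes>\<^sub>K nth_mat_deriv g (i + d) x) =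
      scalar_bell (\<lambda>l. contract D X 1 l (nth_mat_deriv g l x)) (n - i) (k - 1) *
        contract D X 1 (i + d) (nth_mat_deriv g (i + d) x)"
    if "i \<in> I" for i
  proof -
    \<comment> \<open>As i \<le> n and k \<ge> 1, no subtraction is truncated, and the sizes of the
      two factors multiply to the required size.\<close>
    have nd: "n + d = (n - i) + (i + d)" and kd: "k = (k - 1) + 1"
      using I that \<open>1 \<le> k\<close> by auto
    have P: "nth_mat_deriv g (i + d) x \<in> carrier_mat (CARD('b) ^ 1) (CARD('a) ^ (i + d))"
      by simp
    show "bell g (n - i) (k - 1) x \<otimes>\<^sub>K nth_mat_deriv g (i + d) x \<in> carrier_mat (CARD('b) ^ k) (CARD('a) ^ (n + d))"
      using kronecker_carrier[OF bell_carrier[of g "n - i" "k - 1" x] P]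
      by (simp only: power_add[symmetric] nd[symmetric] kd[symmetric])
    show "contract D X k (n + d) (bell g (n - i) (k - 1) x \<otimes>\<^sub>K nth_mat_deriv g (i + d) x) =
      scalar_bell (\<lambda>l. contract D X 1 l (nth_mat_deriv g l x)) (n - i) (k - 1) *
        contract D X 1 (i + d) (nth_mat_deriv g (i + d) x)"
      using contract_kronecker[OF D X bell_carrier[of g "n - i" "k - 1" x] P]
      by (simp only: nd[symmetric] kd[symmetric] contract_bell[OF D X])
  qed
  show "contract D X k (n + d) S =
      (\<Sum>i\<in>I. c i * (scalar_bell (\<lambda>l. contract D X 1 l (nth_mat_deriv g l x)) (n - i) (k - 1) *
        contract D X 1 (i + d) (nth_mat_deriv g (i + d) x)))"
    unfolding S_def
    by (subst contract_mat_sum[OF D X], intro smult_carrier_mat K, assumption, intro sum.cong refl)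
      (simp only: contract_smult[OF D X K(1)] K(2))
qed

section \<open>The three recurrences\<close>

theorem proposition1:
  fixes g :: "real ^ 'a::{finite,linorder} \<Rightarrow> real ^ 'b::{finite,linorder}"
    and U :: "(real ^ 'a::{finite,linorder}) set"
    and D X :: "real mat"
    and n k :: nat
  assumes "1 \<le> n" and "1 \<le> k"
    and "open U"
    and "D \<in> carrier_mat 1 CARD('b)"
    and "X \<in> carrier_mat CARD('a) 1"
  shows "(times_differentiable_on n g U \<longrightarrow> (\<forall>x\<in>U.
      kronecker_power D k * bell g n k x * kronecker_power X n =
      kronecker_power D k *
        mat_sum (CARD('b) ^ k) (CARD('a) ^ n)
          (\<lambda>i. real ((n - 1) choose (i - 1)) \<cdot>\<^sub>m
             (bell g (n - i) (k - 1) x \<otimes>\<^sub>K nth_mat_deriv g i x))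
          {1..n + 1 - k} *
        kronecker_power X n)) \<and>
    (times_differentiable_on (n + 1) g U \<longrightarrow> (\<forall>x\<in>U.
      kronecker_power D k * mat_deriv (bell g n k) x * kronecker_power X (n + 1) =
      kronecker_power D k *
        mat_sum (CARD('b) ^ k) (CARD('a) ^ (n + 1))
          (\<lambda>i. real (n choose i) \<cdot>\<^sub>m
             (bell g (n - i) (k - 1) x \<otimes>\<^sub>K nth_mat_deriv g (i + 1) x))
          {1..n + 1 - k} *
        kronecker_power X (n + 1))) \<and>
    (times_differentiable_on (n + 1) g U \<longrightarrow> (\<forall>x\<in>U.
      kronecker_power D k * bell g (n + 1) k x * kronecker_power X (n + 1) =
      kronecker_power D k *
        ((bell g n (k - 1) x \<otimes>\<^sub>K nth_mat_deriv g 1 x) + mat_deriv (bell g n k) x) *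
        kronecker_power X (n + 1)))"
proof -
  note D = \<open>D \<in> carrier_mat 1 CARD('b)\<close> and X = \<open>X \<in> carrier_mat CARD('a) 1\<close>
  define y where "y x l = contract D X 1 l (nth_mat_deriv g l x)" for x l
  \<comment> \<open>Differentiation along X needs a vector of the domain of g; v is the one whose
    column is the given matrix X.\<close>
  define v :: "real ^ 'a::{finite,linorder}" where "v = (\<chi> a. X $$ (inv_into {..<CARD('a)} idx a, 0))"
  have v: "column v = X"
  proof (rule eq_matI)
    fix i j assume "i < dim_row X" "j < dim_col X"
    then have "i < CARD('a)" "j = 0" using X by auto
    then show "column v $$ (i, j) = X $$ (i, j)"
      using bij_betw_inv_into_left[OF bij_betw_idx, of i, where 'a1 = 'a] by (simp add: column_def v_def)
  qed (use X in \<open>auto simp: column_def\<close>)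
  have deriv_carrier: "mat_deriv (bell g n k) x \<in> carrier_mat (CARD('b) ^ k) (CARD('a) ^ (n + 1))" for x
    using mat_deriv_carrier[of "bell g n k" x, OF bell_carrier] by (simp add: mult.commute)

  \<comment> \<open>The scalar form of (i) at m + 1, with the index shifted by one and its lowest
    term split off. For k > m + 1 everything vanishes.\<close>
  have first_recurrence: "scalar_bell (y x) (m + 1) k =
      y x 1 * scalar_bell (y x) m (k - 1) +
      (\<Sum>i = 1..m + 1 - k. real (m choose i) * (scalar_bell (y x) (m - i) (k - 1) * y x (i + 1)))" for x m
  proof (cases "k \<le> m + 1")
    case True
    have "scalar_bell (y x) (m + 1) k =
      (\<Sum>i = 1..m + 2 - k. real (m choose (i - 1)) * (scalar_bell (y x) (m + 1 - i) (k - 1) * y x i))"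
      using scalar_bell_rec[of "m + 1" k "y x"] \<open>1 \<le> k\<close> by simp
    also have "\<dots> = (\<Sum>i = 0..m + 1 - k. real (m choose i) * (scalar_bell (y x) (m - i) (k - 1) * y x (i + 1)))"
      using True by (intro sum.reindex_bij_witness[where i = Suc and j = "\<lambda>i. i - 1"]) auto
    finally show ?thesis by (simp add: sum.atLeast_Suc_atMost)
  qed (simp add: scalar_bell_def egf_power_nth_less)

  \<comment> \<open>The contracted Bell matrix along x + t v is differentiated at t = 0 in two ways:
    as a scalar Bell polynomial in the y_l, and through the contraction of its matrix derivative.
    Uniqueness of the derivative gives (ii).\<close>
  have contract_deriv: "contract D X k (n + 1) (mat_deriv (bell g n k) x) =
      (\<Sum>i = 1..n + 1 - k. real (n choose i) * (scalar_bell (y x) (n - i) (k - 1) * y x (i + 1)))"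
    if g: "times_differentiable_on (n + 1) g U" and x: "x \<in> U" for x
  proof -
    have diff: "mat_differentiable CARD('b) (CARD('a) ^ l) (nth_mat_deriv g l) x" if "l \<le> n" for l
    proof -
      have "times_differentiable_on (1 + l) g U"
        using that by (intro times_differentiable_on_mono[OF g]) simp
      from times_differentiable_on_nth_mat_deriv[OF \<open>open U\<close> this] x show ?thesis
        by (simp add: mat_differentiable_def)
    qed
    \<comment> \<open>Contracting g_{x^l} with one more X raises its order, so the derivative of y_l
      is y_{l+1}. The point x is written \<open>x + 0 *\<^sub>R v\<close> to be the value at t = 0
      of the same curve.\<close>
    have "((\<lambda>t. y (x + t *\<^sub>R v) l) has_real_derivative y (x + 0 *\<^sub>R v) (l + 1)) (at 0)" if "l \<le> n" for l
      using contract_mat_deriv[OF D, of 1 l "nth_mat_deriv g l" x v] diff[OF that]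
      by (simp add: y_def v nth_mat_deriv_def)
    then have "((\<lambda>t. scalar_bell (y (x + t *\<^sub>R v)) n k) has_real_derivative
      (\<Sum>i = 1..n + 1 - k. real (n choose i) * (scalar_bell (y (x + 0 *\<^sub>R v)) (n - i) (k - 1) * y (x + 0 *\<^sub>R v) (i + 1)))) (at 0)"
      using \<open>1 \<le> k\<close> by (intro scalar_bell_has_real_derivative) auto
    moreover have "((\<lambda>t. scalar_bell (y (x + t *\<^sub>R v)) n k) has_real_derivative
      contract D X k (n + 1) (mat_deriv (bell g n k) x)) (at 0)"
      using contract_mat_deriv[OF D mat_differentiable_bell[OF diff], where v = v and k = k]
      unfolding v contract_bell[OF D X] y_def[symmetric] by simp
    ultimately show ?thesis using DERIV_unique by fastforce
  qed

  show ?thesis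
  proof (intro conjI impI ballI)
    fix x assume "x \<in> U"
    let ?S = "mat_sum (CARD('b) ^ k) (CARD('a) ^ n)
          (\<lambda>i. real ((n - 1) choose (i - 1)) \<cdot>\<^sub>m (bell g (n - i) (k - 1) x \<otimes>\<^sub>K nth_mat_deriv g i x))
          {1..n + 1 - k}"
    have I: "{1..n + 1 - k} \<subseteq> {..n}" using \<open>1 \<le> k\<close> by auto
    note S = contract_bell_sum[OF D X \<open>1 \<le> k\<close> I, where d = 0 and g = g and x = x
      and c = "\<lambda>i. real ((n - 1) choose (i - 1))", unfolded add_0_right]
    show "kronecker_power D k * bell g n k x * kronecker_power X n =
      kronecker_power D k * ?S * kronecker_power X n"
      unfolding contract_eq_iff[OF D X bell_carrier S(1)] contract_bell[OF D X] S(2)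
      by (rule scalar_bell_rec[OF \<open>1 \<le> n\<close> \<open>1 \<le> k\<close>])
  next
    fix x assume g: "times_differentiable_on (n + 1) g U" and x: "x \<in> U"
    let ?S = "mat_sum (CARD('b) ^ k) (CARD('a) ^ (n + 1))
          (\<lambda>i. real (n choose i) \<cdot>\<^sub>m (bell g (n - i) (k - 1) x \<otimes>\<^sub>K nth_mat_deriv g (i + 1) x))
          {1..n + 1 - k}"
    have I: "{1..n + 1 - k} \<subseteq> {..n}" using \<open>1 \<le> k\<close> by auto
    note S = contract_bell_sum[OF D X \<open>1 \<le> k\<close> I, where d = 1 and g = g and x = x
      and c = "\<lambda>i. real (n choose i)"]
    show "kronecker_power D k * mat_deriv (bell g n k) x * kronecker_power X (n + 1) =
      kronecker_power D k * ?S * kronecker_power X (n + 1)"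
      unfolding contract_eq_iff[OF D X deriv_carrier S(1)] S(2) contract_deriv[OF g x] y_def ..
  next
    fix x assume g: "times_differentiable_on (n + 1) g U" and x: "x \<in> U"
    have P: "nth_mat_deriv g 1 x \<in> carrier_mat (CARD('b) ^ 1) (CARD('a) ^ 1)"
      using nth_mat_deriv_carrier[of g 1 x] by simp
    have B: "bell g n (k - 1) x \<otimes>\<^sub>K nth_mat_deriv g 1 x \<in> carrier_mat (CARD('b) ^ k) (CARD('a) ^ (n + 1))"
      using kronecker_carrier[OF bell_carrier[of g n "k - 1" x] P] \<open>1 \<le> k\<close>
      by (simp only: power_add[symmetric] le_add_diff_inverse2)
    have "contract D X k (n + 1) (bell g n (k - 1) x \<otimes>\<^sub>K nth_mat_deriv g 1 x) =
        scalar_bell (y x) n (k - 1) * y x 1"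
      using contract_kronecker[OF D X bell_carrier[of g n "k - 1" x] P] \<open>1 \<le> k\<close>
      by (simp only: le_add_diff_inverse2 contract_bell[OF D X] y_def[symmetric])
    then show "kronecker_power D k * bell g (n + 1) k x * kronecker_power X (n + 1) =
      kronecker_power D k *
        ((bell g n (k - 1) x \<otimes>\<^sub>K nth_mat_deriv g 1 x) + mat_deriv (bell g n k) x) *
        kronecker_power X (n + 1)"
      \<comment> \<open>After contraction the Kronecker term is the part split off in
        \<open>first_recurrence\<close> at m = n, and the derivative term is the remaining sum by
        \<open>contract_deriv\<close>.\<close>
      unfolding contract_eq_iff[OF D X bell_carrier add_carrier_mat[OF deriv_carrier]]
        contract_add[OF D X B deriv_carrier] contract_bell[OF D X] contract_deriv[OF g x]
        y_def[symmetric] first_recurrence by simp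
  qed
qed

end
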